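(* Let $\gamma:\mathbb{S}\to\mathbb{R}^2$ be a smooth closed translator for the curve diffusion flow, i.e. there is a constant vector $V\in\mathbb{R}^2$ with $-\kappa_{ss}=\langle V,\nu\rangle$ along $\gamma$. Then $\gamma$ is trivial (that is, $V=0$), and $\gamma(\mathbb{S})$ is a standard round circle.
   Context: Curves are smooth and regular; $s$ is arc length, $\nu$ a smooth unit normal field, and $\kappa=\langle\gamma_{ss},\nu\rangle$. The curve diffusion flow is $\langle \partial_t\gamma,\nu\rangle=-\kappa_{ss}$. A translator is a curve satisfying $-\kappa_{ss}\equiv\langle V,\nu\rangle$ for some constant vector $V$; it is trivial if $V=0$ (then it is stationary). *)

theory Defs
  imports "HOL-Analysis.Analysis"
begin

text \<open>
  The circle \<open>\<S>\<close> is realised as the unit circle in the complex plane, so a closed curve is a map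
  \<open>complex \<Rightarrow> real ^ 2\<close> of which only the values on \<^term>\<open>sphere (0::complex) 1\<close> matter.
  Functions on the circle are differentiated along the angular coordinate: for
  \<open>z = cis \<theta>\<close>, \<open>circle_deriv f z\<close> is the derivative of \<open>t \<mapsto> f (cis t)\<close> at \<open>\<theta>\<close>.
\<close>

abbreviation unit_circle :: "complex set" where
  "unit_circle \<equiv> sphere 0 1"

definition circle_deriv :: "(complex \<Rightarrow> 'a::real_normed_vector) \<Rightarrow> complex \<Rightarrow> 'a" where
  "circle_deriv f z = vector_derivative (\<lambda>t. f (z * cis t)) (at 0)"

text \<open>Smooth means infinitely differentiable: every iterated derivative is again differentiable.\<close>

definition smooth_on_circle :: "(complex \<Rightarrow> 'a::real_normed_vector) \<Rightarrow> bool" where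
  "smooth_on_circle f \<longleftrightarrow>
     (\<forall>n. \<forall>z\<in>unit_circle. (\<lambda>t. (circle_deriv ^^ n) f (z * cis t)) differentiable (at 0))"

text \<open>Curves are immersed; they may have self-intersections and may be multiply covered.\<close>

definition smooth_closed_curve :: "(complex \<Rightarrow> real ^ 2) \<Rightarrow> bool" where
  "smooth_closed_curve \<gamma> \<longleftrightarrow>
     smooth_on_circle \<gamma> \<and> (\<forall>z\<in>unit_circle. circle_deriv \<gamma> z \<noteq> 0)"

text \<open>Differentiation with respect to the arc length \<open>s\<close> of \<open>\<gamma>\<close>, for which
  \<open>ds = \<bar>\<gamma>'(\<theta>)\<bar> d\<theta>\<close>.\<close>

definition arclength_deriv ::
    "(complex \<Rightarrow> real ^ 2) \<Rightarrow> (complex \<Rightarrow> 'a::real_normed_vector) \<Rightarrow> complex \<Rightarrow> 'a" where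
  "arclength_deriv \<gamma> f z = circle_deriv f z /\<^sub>R norm (circle_deriv \<gamma> z)"

definition unit_normal_field :: "(complex \<Rightarrow> real ^ 2) \<Rightarrow> (complex \<Rightarrow> real ^ 2) \<Rightarrow> bool" where
  "unit_normal_field \<gamma> \<nu> \<longleftrightarrow>
     smooth_on_circle \<nu> \<and>
     (\<forall>z\<in>unit_circle. norm (\<nu> z) = 1 \<and> \<nu> z \<bullet> circle_deriv \<gamma> z = 0)"

definition curvature ::
    "(complex \<Rightarrow> real ^ 2) \<Rightarrow> (complex \<Rightarrow> real ^ 2) \<Rightarrow> complex \<Rightarrow> real" where
  "curvature \<gamma> \<nu> z = arclength_deriv \<gamma> (arclength_deriv \<gamma> \<gamma>) z \<bullet> \<nu> z"

definition curve_diffusion_translator ::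
    "(complex \<Rightarrow> real ^ 2) \<Rightarrow> (complex \<Rightarrow> real ^ 2) \<Rightarrow> real ^ 2 \<Rightarrow> bool" where
  "curve_diffusion_translator \<gamma> \<nu> V \<longleftrightarrow>
     (\<forall>z\<in>unit_circle.
        - arclength_deriv \<gamma> (arclength_deriv \<gamma> (curvature \<gamma> \<nu>)) z = V \<bullet> \<nu> z)"

end

theory Submission
  imports Defs
begin

text \<open>
  Along a translator, \<open>F = \<kappa> \<kappa>\<^sub>s + \<langle>V, \<tau>\<rangle>\<close> satisfies
  \<open>F\<^sub>s = \<kappa>\<^sub>s\<^sup>2 + \<kappa> (\<kappa>\<^sub>s\<^sub>s + \<langle>V, \<nu>\<rangle>) = \<kappa>\<^sub>s\<^sup>2 \<ge> 0\<close>. On a closed curve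
  \<open>F\<close> is periodic, hence constant, so \<open>\<kappa>\<close> is constant and \<open>\<langle>V, \<nu>\<rangle> = 0\<close>. At a maximum of
  \<open>\<langle>V, \<gamma>\<rangle>\<close> also \<open>\<langle>V, \<tau>\<rangle> = 0\<close>, which forces \<open>V = 0\<close>. The constant \<open>\<kappa>\<close> is nonzero because
  a closed curve has no constant tangent, and then \<open>\<gamma> + \<nu> / \<kappa>\<close> is the centre of the circle.
\<close>

section \<open>Periodic functions\<close>

text \<open>Compactness gives a maximum over one closed period, periodicity makes it global, and the
  derivative vanishes there because it is an interior maximum on the whole line.\<close>

lemma periodic_attains_max:
  fixes f :: "real \<Rightarrow> real"
  assumes der: "\<And>t. (f has_real_derivative f' t) (at t)"
    and per: "\<And>t. f (t + 2 * pi) = f t"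
  obtains t where "\<And>s. f s \<le> f t" "f' t = 0"
proof -
  have "continuous_on {0..2 * pi} f"
    by (rule DERIV_continuous_on[OF has_field_derivative_at_within[OF der]])
  then obtain t where t: "t \<in> {0..2 * pi}" "\<And>s. s \<in> {0..2 * pi} \<Longrightarrow> f s \<le> f t"
    using continuous_attains_sup[of "{0..2 * pi}" f] by auto
  have per_int: "f (s + 2 * pi * of_int n) = f s" for s n
  proof (induction n rule: int_induct[where k = 0])
    case (step1 i)
    then show ?case
      using per[of "s + 2 * pi * of_int i"] by (simp add: algebra_simps)
  next
    case (step2 i)
    then show ?case
      using per[of "s + 2 * pi * of_int (i - 1)"] by (simp add: algebra_simps)
  qed simp
  have max: "f s \<le> f t" for s
  proof -
    \<comment> \<open>The whole periods contained in \<open>s\<close> are removed, which moves it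
      into the compact interval.\<close>
    define n where "n = \<lfloor>s / (2 * pi)\<rfloor>"
    have "of_int n \<le> s / (2 * pi)" "s / (2 * pi) \<le> of_int n + 1"
      unfolding n_def by linarith+
    then have "s + 2 * pi * of_int (- n) \<in> {0..2 * pi}"
      by (simp add: field_simps)
    then show ?thesis
      using t(2) per_int by metis
  qed
  moreover have "f' t = 0"
    using DERIV_local_max[OF der[of t], of 1] max by auto
  ultimately show ?thesis
    using that by blast
qed

text \<open>A nondecreasing \<open>f\<close> is squeezed between \<open>f t\<close> and
  \<open>f (t + 2 * pi) = f t\<close>, and likewise to the left of \<open>t\<close>, so it is
  constant near \<open>t\<close>.\<close>

lemma periodic_nonneg_deriv_eq_0:
  fixes f :: "real \<Rightarrow> real"
  assumes der: "\<And>t. (f has_real_derivative f' t) (at t)"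
    and per: "\<And>t. f (t + 2 * pi) = f t"
    and nonneg: "\<And>t. 0 \<le> f' t"
  shows "f' t = 0"
proof -
  have mono: "f a \<le> f b" if "a \<le> b" for a b
    using DERIV_nonneg_imp_nondecreasing[OF that] der nonneg by blast
  have "f t = f s" if "\<bar>t - s\<bar> < 2 * pi" for s
    using mono[of t s] mono[of s "t + 2 * pi"] mono[of s t] mono[of "t - 2 * pi" s]
      per[of t] per[of "t - 2 * pi"] that by (cases "t \<le> s") auto
  then show ?thesis
    using DERIV_local_const[OF der[of t], of "2 * pi"] by auto
qed

section \<open>Closed curves in terms of the Frenet equations\<close>

text \<open>The determinant \<open>d\<close> of the frame satisfies \<open>d * d = 1\<close> by
  Lagrange's identity, and Cramer's rule turns the two orthogonality relations into
  \<open>d * x = 0\<close> in each coordinate.\<close>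

lemma eq_0_if_orthogonal_to_frame:
  fixes x u v :: "real ^ 2"
  assumes "norm u = 1" "norm v = 1" "u \<bullet> v = 0" "x \<bullet> u = 0" "x \<bullet> v = 0"
  shows "x = 0"
proof -
  have u: "u $ 1 * u $ 1 + u $ 2 * u $ 2 = 1" and v: "v $ 1 * v $ 1 + v $ 2 * v $ 2 = 1"
    using assms(1,2) by (simp_all add: norm_eq_1 inner_vec_def sum_2)
  have uv: "u $ 1 * v $ 1 + u $ 2 * v $ 2 = 0" and xu: "x $ 1 * u $ 1 + x $ 2 * u $ 2 = 0"
    and xv: "x $ 1 * v $ 1 + x $ 2 * v $ 2 = 0"
    using assms(3-5) by (simp_all add: inner_vec_def sum_2)
  define d where "d = u $ 1 * v $ 2 - u $ 2 * v $ 1"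
  have "d * d = 1"
    unfolding d_def using u v uv by algebra
  moreover have "d * x $ 1 = 0" "d * x $ 2 = 0"
    unfolding d_def using xu xv by algebra+
  ultimately have "x $ 1 = 0" "x $ 2 = 0"
    by auto
  then show ?thesis
    by (simp add: vec_eq_iff forall_2)
qed

lemma frame_expansion:
  fixes x u v :: "real ^ 2"
  assumes "norm u = 1" "norm v = 1" "u \<bullet> v = 0"
  shows "x = (x \<bullet> u) *\<^sub>R u + (x \<bullet> v) *\<^sub>R v"
proof -
  have "u \<bullet> u = 1" "v \<bullet> v = 1" "v \<bullet> u = 0"
    using assms by (simp_all add: norm_eq_1 inner_commute)
  then have "x - ((x \<bullet> u) *\<^sub>R u + (x \<bullet> v) *\<^sub>R v) = 0"
    using assms by (intro eq_0_if_orthogonal_to_frame[OF assms]) (simp_all add: algebra_simps)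
  then show ?thesis
    by simp
qed

lemma has_vector_derivative_inner:
  assumes "(f has_vector_derivative f') (at t)" "(g has_vector_derivative g') (at t)"
  shows "((\<lambda>t. f t \<bullet> g t) has_real_derivative f t \<bullet> g' + f' \<bullet> g t) (at t)"
  using bounded_bilinear.has_vector_derivative[OF bounded_bilinear_inner assms]
  by (simp add: has_real_derivative_iff_has_vector_derivative)

text \<open>\<open>v\<close> is the speed and \<open>\<kappa>\<^sub>1\<close> the arc length derivative of the curvature.\<close>

locale closed_frenet_curve =
  fixes g \<tau> \<nu> :: "real \<Rightarrow> real ^ 2" and v \<kappa> \<kappa>\<^sub>1 :: "real \<Rightarrow> real"
  assumes speed_pos: "\<And>t. 0 < v t"
    and norm_\<tau>: "\<And>t. norm (\<tau> t) = 1" and norm_\<nu>: "\<And>t. norm (\<nu> t) = 1"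
    and orthogonal: "\<And>t. \<tau> t \<bullet> \<nu> t = 0"
    and deriv_g: "\<And>t. (g has_vector_derivative v t *\<^sub>R \<tau> t) (at t)"
    and deriv_\<tau>: "\<And>t. (\<tau> has_vector_derivative (v t * \<kappa> t) *\<^sub>R \<nu> t) (at t)"
    and deriv_\<nu>: "\<And>t. (\<nu> has_vector_derivative - (v t * \<kappa> t) *\<^sub>R \<tau> t) (at t)"
    and deriv_\<kappa>: "\<And>t. (\<kappa> has_real_derivative v t * \<kappa>\<^sub>1 t) (at t)"
    and periodic: "\<And>t. g (t + 2 * pi) = g t" "\<And>t. \<tau> (t + 2 * pi) = \<tau> t"
      "\<And>t. \<nu> (t + 2 * pi) = \<nu> t" "\<And>t. \<kappa> (t + 2 * pi) = \<kappa> t" "\<And>t. \<kappa>\<^sub>1 (t + 2 * pi) = \<kappa>\<^sub>1 t"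
begin

text \<open>The height of the closed curve in direction \<open>V\<close> has a maximum, and it is
  critical there.\<close>

lemma tangent_orthogonal_somewhere:
  obtains t where "\<tau> t \<bullet> V = 0"
proof -
  have "((\<lambda>t. g t \<bullet> V) has_real_derivative v t * (\<tau> t \<bullet> V)) (at t)" for t
    using has_vector_derivative_inner[OF deriv_g[of t] has_vector_derivative_const[of V]] by simp
  then obtain t where "v t * (\<tau> t \<bullet> V) = 0"
    by (rule periodic_attains_max) (simp_all add: periodic(1))
  with speed_pos[of t] that show ?thesis
    by auto
qed

lemma translator_curvature_deriv_eq_0:
  assumes "\<And>t. (\<kappa>\<^sub>1 has_real_derivative - (v t * (V \<bullet> \<nu> t))) (at t)"
  shows "\<kappa>\<^sub>1 t = 0"
proof -
  have "((\<lambda>t. \<kappa> t * \<kappa>\<^sub>1 t + V \<bullet> \<tau> t) has_real_derivative v t * (\<kappa>\<^sub>1 t)\<^sup>2) (at t)" for t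
    \<comment> \<open>The hypothesis contributes
      \<open>- v t * \<kappa> t * (V \<bullet> \<nu> t)\<close>, which cancels against the
      derivative of \<open>V \<bullet> \<tau> t\<close>.\<close>
    using DERIV_add[OF DERIV_mult[OF deriv_\<kappa>[of t] assms[of t]]
        has_vector_derivative_inner[OF has_vector_derivative_const[of V] deriv_\<tau>[of t]]]
    by (rule back_subst) (simp add: algebra_simps power2_eq_square)
  then have "v t * (\<kappa>\<^sub>1 t)\<^sup>2 = 0"
    by (rule periodic_nonneg_deriv_eq_0)
      (auto simp: periodic intro!: mult_nonneg_nonneg less_imp_le[OF speed_pos])
  with speed_pos[of t] show ?thesis
    by simp
qed

lemma normal_orthogonal_imp_eq_0:
  assumes "\<And>t. V \<bullet> \<nu> t = 0"
  shows "V = 0"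
proof -
  obtain t where "\<tau> t \<bullet> V = 0"
    by (rule tangent_orthogonal_somewhere)
  with assms[of t] norm_\<tau>[of t] norm_\<nu>[of t] orthogonal[of t] show ?thesis
    by (intro eq_0_if_orthogonal_to_frame[of "\<tau> t" "\<nu> t"]) (auto simp: inner_commute)
qed

text \<open>Constancy of the centre \<open>g + \<nu> / k\<close> only puts the curve inside a
  circle. That the whole circle is covered follows from surjectivity of the normal onto the unit
  vectors.\<close>

lemma const_curvature_imp_circle:
  assumes const: "\<And>t. \<kappa>\<^sub>1 t = 0"
  shows "\<exists>c r. r > 0 \<and> range g = sphere c r"
proof -
  obtain k where k: "\<And>t. \<kappa> t = k"
  proof -
    have "\<kappa> t = \<kappa> 0" for t
      using deriv_\<kappa> const by (intro DERIV_isconst_all) auto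
    then show ?thesis using that by blast
  qed
  have "k \<noteq> 0"
  proof
    assume "k = 0"
    then have "(\<tau> has_vector_derivative 0) (at t within UNIV)" for t
      using deriv_\<tau>[of t] k by simp
    then obtain T where T: "\<And>t. \<tau> t = T"
      using has_vector_derivative_zero_constant[of UNIV \<tau>] by auto
    \<comment> \<open>Taking the constant tangent \<open>T\<close> itself as direction gives
      \<open>T \<bullet> T = 0\<close>.\<close>
    obtain t where "\<tau> t \<bullet> T = 0"
      by (rule tangent_orthogonal_somewhere)
    with T norm_\<tau>[of t] show False
      by simp
  qed
  have "((\<lambda>t. g t + (1 / k) *\<^sub>R \<nu> t) has_vector_derivative 0) (at t within UNIV)" for t
  proof -
    have "((\<lambda>t. g t + (1 / k) *\<^sub>R \<nu> t) has_vector_derivative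
        v t *\<^sub>R \<tau> t + (1 / k) *\<^sub>R (- (v t * \<kappa> t) *\<^sub>R \<tau> t)) (at t)"
      by (intro has_vector_derivative_add deriv_g
          bounded_linear.has_vector_derivative[OF bounded_linear_scaleR_right] deriv_\<nu>)
    with k \<open>k \<noteq> 0\<close> show ?thesis
      by simp
  qed
  then obtain c where "\<And>t. g t + (1 / k) *\<^sub>R \<nu> t = c"
    using has_vector_derivative_zero_constant[of UNIV "\<lambda>t. g t + (1 / k) *\<^sub>R \<nu> t"] by auto
  then have g: "g t = c - (1 / k) *\<^sub>R \<nu> t" for t
    by (metis add_diff_cancel_right')
  \<comment> \<open>At a maximum of \<open>\<nu> \<bullet> p\<close> the tangent is orthogonal to
    \<open>p\<close>, since \<open>k\<close> is nonzero. Hence \<open>p\<close> is plus or minus the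
    normal there, and the minus sign has to be excluded.\<close>
  have normal_surj: "p \<in> range \<nu>" if "norm p = 1" for p
  proof -
    have "((\<lambda>t. \<nu> t \<bullet> p) has_real_derivative - (v t * k) * (\<tau> t \<bullet> p)) (at t)" for t
      using has_vector_derivative_inner[OF deriv_\<nu>[of t] has_vector_derivative_const[of p]] k
      by simp
    then obtain t where t: "\<And>s. \<nu> s \<bullet> p \<le> \<nu> t \<bullet> p" "- (v t * k) * (\<tau> t \<bullet> p) = 0"
      using periodic_attains_max[of "\<lambda>t. \<nu> t \<bullet> p" "\<lambda>t. - (v t * k) * (\<tau> t \<bullet> p)"] periodic(3) by auto
    then have "p \<bullet> \<tau> t = 0"
      using speed_pos[of t] \<open>k \<noteq> 0\<close> by (simp add: inner_commute)
    then have p: "p = (p \<bullet> \<nu> t) *\<^sub>R \<nu> t"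
      using frame_expansion[OF norm_\<tau> norm_\<nu> orthogonal, of p t] by simp
    then have "\<bar>p \<bullet> \<nu> t\<bar> = 1"
      using that norm_\<nu>[of t] by (metis mult.right_neutral norm_scaleR)
    then consider "p = \<nu> t" | "\<nu> t \<bullet> p = - 1"
      using p by (auto simp: abs_if inner_commute split: if_splits)
    then show ?thesis
    proof cases
      case 2
      \<comment> \<open>The maximum of \<open>\<langle>\<nu>, p\<rangle>\<close> is the least possible value, so the normal would be constant.\<close>
      have "\<nu> s = - p" for s
      proof -
        \<comment> \<open>The square expands to \<open>2 + 2 * (\<nu> s \<bullet> p)\<close>, and
          the inner product is at most its maximum \<open>- 1\<close>.\<close>
        have "norm (\<nu> s + p) ^ 2 \<le> 0"
          using t(1)[of s] 2 that norm_\<nu>[of s]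
          by (simp add: power2_norm_eq_inner algebra_simps norm_eq_1 inner_commute)
        then show ?thesis
          by (simp add: eq_neg_iff_add_eq_0)
      qed
      then have "\<nu> = (\<lambda>_. - p)"
        by blast
      then have "(\<nu> has_vector_derivative 0) (at t)"
        by simp
      then have "- (v t * \<kappa> t) *\<^sub>R \<tau> t = 0"
        using deriv_\<nu> vector_derivative_unique_at by blast
      then show ?thesis
        using k \<open>k \<noteq> 0\<close> speed_pos[of t] norm_\<tau>[of t] by auto
    qed auto
  qed
  have "range g = sphere c (1 / \<bar>k\<bar>)"
  proof (intro equalityI subsetI)
    fix x assume "x \<in> range g"
    then show "x \<in> sphere c (1 / \<bar>k\<bar>)"
      using g norm_\<nu> by (auto simp: dist_norm)
  next
    fix x assume x: "x \<in> sphere c (1 / \<bar>k\<bar>)"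
    \<comment> \<open>Solving \<open>x = c - \<nu> t / k\<close> for the normal gives this
      vector.\<close>
    then have "norm (k *\<^sub>R (c - x)) = 1"
      using \<open>k \<noteq> 0\<close> by (simp add: dist_norm)
    then obtain t where "k *\<^sub>R (c - x) = \<nu> t"
      using normal_surj by blast
    then have "g t = x"
      using g[of t] \<open>k \<noteq> 0\<close> by (simp flip: \<open>k *\<^sub>R (c - x) = \<nu> t\<close>)
    then show "x \<in> range g"
      by blast
  qed
  then show ?thesis
    using \<open>k \<noteq> 0\<close> by (metis zero_less_abs_iff zero_less_divide_1_iff)
qed

end

section \<open>Repeated differentiability on the line\<close>

definition vderiv :: "(real \<Rightarrow> 'a::real_normed_vector) \<Rightarrow> real \<Rightarrow> 'a" where
  "vderiv f t = vector_derivative f (at t)"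

text \<open>Counting a finite order lets the closure properties go by induction; smoothness is used
  as validity for every \<open>n\<close>.\<close>

primrec times_differentiable :: "nat \<Rightarrow> (real \<Rightarrow> 'a::real_normed_vector) \<Rightarrow> bool" where
  "times_differentiable 0 f \<longleftrightarrow> True"
| "times_differentiable (Suc n) f \<longleftrightarrow>
     (\<forall>t. f differentiable (at t)) \<and> times_differentiable n (vderiv f)"

lemma has_vector_derivative_vderiv:
  "times_differentiable (Suc n) f \<Longrightarrow> (f has_vector_derivative vderiv f t) (at t)"
  by (simp add: vderiv_def vector_derivative_works)

text \<open>An explicit derivative at every point is \<open>vderiv f\<close> as a function. This is
  the induction step of all closure lemmas below.\<close>

lemma times_differentiable_SucI:
  assumes "\<And>t. (f has_vector_derivative f' t) (at t)" "times_differentiable n f'"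
  shows "times_differentiable (Suc n) f"
proof -
  have "vderiv f = f'"
    using assms(1) by (auto simp: vderiv_def vector_derivative_at)
  with assms show ?thesis
    by (auto intro: differentiableI_vector)
qed

lemma times_differentiable_Suc_imp:
  "times_differentiable (Suc n) f \<Longrightarrow> times_differentiable n f"
  by (induction n arbitrary: f) auto

lemma times_differentiable_add:
  "times_differentiable n f \<Longrightarrow> times_differentiable n g \<Longrightarrow>
    times_differentiable n (\<lambda>t. f t + g t)"
proof (induction n arbitrary: f g)
  case (Suc n)
  show ?case
    by (rule times_differentiable_SucI[OF has_vector_derivative_add[OF
          has_vector_derivative_vderiv[OF Suc.prems(1)] has_vector_derivative_vderiv[OF Suc.prems(2)]]])
      (use Suc in auto)
qed simp

lemma times_differentiable_bilinear:
  assumes "bounded_bilinear B"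
  shows "times_differentiable n f \<Longrightarrow> times_differentiable n g \<Longrightarrow>
    times_differentiable n (\<lambda>t. B (f t) (g t))"
proof (induction n arbitrary: f g)
  case (Suc n)
  show ?case
    by (rule times_differentiable_SucI[OF bounded_bilinear.has_vector_derivative[OF assms
          has_vector_derivative_vderiv[OF Suc.prems(1)] has_vector_derivative_vderiv[OF Suc.prems(2)]]])
      (intro times_differentiable_add Suc.IH times_differentiable_Suc_imp[OF Suc.prems(1)]
        times_differentiable_Suc_imp[OF Suc.prems(2)], use Suc.prems in auto)
qed simp

lemmas times_differentiable_mult = times_differentiable_bilinear[OF bounded_bilinear_mult]
lemmas times_differentiable_scaleR = times_differentiable_bilinear[OF bounded_bilinear_scaleR]
lemmas times_differentiable_inner = times_differentiable_bilinear[OF bounded_bilinear_inner]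

lemma times_differentiable_const: "times_differentiable n (\<lambda>t. c)"
proof (induction n arbitrary: c)
  case (Suc n)
  show ?case
    by (rule times_differentiable_SucI[OF has_vector_derivative_const Suc.IH])
qed simp

text \<open>With \<open>w = f powr (- 1 / 2)\<close> one has \<open>w' = - f' * w ^ 3 / 2\<close>, a
  product of \<open>f'\<close> and copies of \<open>w\<close>, so the induction hypothesis and the
  product lemma suffice.\<close>

lemma times_differentiable_inverse_sqrt:
  fixes f :: "real \<Rightarrow> real"
  assumes "\<And>t. 0 < f t"
  shows "times_differentiable n f \<Longrightarrow> times_differentiable n (\<lambda>t. inverse (sqrt (f t)))"
proof (induction n)
  case (Suc n)
  let ?w = "\<lambda>t. inverse (sqrt (f t))"
  have "(?w has_vector_derivative (- 1 / 2) * (vderiv f t * (?w t * (?w t * ?w t)))) (at t)" for t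
  proof -
    have "(f has_real_derivative vderiv f t) (at t)"
      using has_vector_derivative_vderiv[OF Suc.prems]
      by (simp add: has_real_derivative_iff_has_vector_derivative)
    then have "(?w has_real_derivative (- 1 / 2) * (vderiv f t * (?w t * (?w t * ?w t)))) (at t)"
      using assms[of t]
      by (auto intro!: derivative_eq_intros simp: field_simps power2_eq_square)
    then show ?thesis
      by (simp add: has_real_derivative_iff_has_vector_derivative)
  qed
  then show ?case
    by (rule times_differentiable_SucI)
      (intro times_differentiable_mult times_differentiable_const,
        use Suc times_differentiable_Suc_imp in auto)
qed simp

section \<open>From the circle to the line\<close>

lemma has_vector_derivative_shift:
  "((\<lambda>t. h (a + t)) has_vector_derivative D) (at 0) \<longleftrightarrow> (h has_vector_derivative D) (at a)"
proof
  assume "((\<lambda>t. h (a + t)) has_vector_derivative D) (at 0)"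
  moreover have "((\<lambda>t. t - a) has_vector_derivative 1) (at a)"
    by (auto intro!: derivative_eq_intros)
  ultimately have "(((\<lambda>t. h (a + t)) \<circ> (\<lambda>t. t - a)) has_vector_derivative 1 *\<^sub>R D) (at a)"
    by (intro vector_diff_chain_at) auto
  then show "(h has_vector_derivative D) (at a)"
    by (simp add: o_def)
next
  assume "(h has_vector_derivative D) (at a)"
  moreover have "((\<lambda>t. a + t) has_vector_derivative 1) (at 0)"
    by (auto intro!: derivative_eq_intros)
  ultimately have "((h \<circ> (\<lambda>t. a + t)) has_vector_derivative 1 *\<^sub>R D) (at 0)"
    by (intro vector_diff_chain_at) auto
  then show "((\<lambda>t. h (a + t)) has_vector_derivative D) (at 0)"
    by (simp add: o_def)
qed

text \<open>The shift equivalence holds for every candidate derivative, so the choice operator in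
  \<open>vector_derivative\<close> picks the same value on both sides, even where no derivative
  exists.\<close>

lemma circle_deriv_cis: "circle_deriv f (cis a) = vderiv (\<lambda>t. f (cis t)) a"
  using has_vector_derivative_shift[of "\<lambda>t. f (cis t)" a]
  by (simp add: circle_deriv_def vderiv_def vector_derivative_def cis_mult)

lemma circle_differentiable_cis:
  "(\<lambda>t. f (cis a * cis t)) differentiable (at 0) \<longleftrightarrow> (\<lambda>t. f (cis t)) differentiable (at a)"
proof -
  have ex: "h differentiable (at b) \<longleftrightarrow> (\<exists>D. (h has_vector_derivative D) (at b))"
    for h :: "real \<Rightarrow> 'a" and b
    by (meson differentiableI_vector vector_derivative_works)
  show ?thesis
    using has_vector_derivative_shift[of "\<lambda>t. f (cis t)" a] by (simp add: ex cis_mult)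
qed

lemma cis_in_unit_circle: "cis t \<in> unit_circle"
  by simp

lemma image_unit_circle: "f ` unit_circle = range (\<lambda>t. f (cis t))"
proof -
  have "unit_circle = range cis"
    by (auto simp: image_iff) (metis cis_Arg complex_norm_eq_1_exp cis_conv_exp)
  then show ?thesis
    by (simp add: image_image)
qed

text \<open>Smoothness passes to \<open>circle_deriv f\<close>, whose iterates are those of
  \<open>f\<close> with the index raised by one; along \<open>cis\<close> this function is
  \<open>vderiv\<close>.\<close>

lemma smooth_on_circle_times_differentiable:
  "smooth_on_circle f \<Longrightarrow> times_differentiable n (\<lambda>t. f (cis t))"
proof (induction n arbitrary: f)
  case (Suc n)
  have "smooth_on_circle (circle_deriv f)"
    using Suc.prems unfolding smooth_on_circle_def by (metis funpow_Suc_right o_apply)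
  then have "times_differentiable n (vderiv (\<lambda>t. f (cis t)))"
    using Suc.IH[of "circle_deriv f"] by (simp only: circle_deriv_cis)
  moreover have "(\<lambda>t. f (cis t)) differentiable (at t)" for t
  proof -
    have "(\<lambda>s. (circle_deriv ^^ 0) f (cis t * cis s)) differentiable (at 0)"
      using Suc.prems cis_in_unit_circle unfolding smooth_on_circle_def by blast
    then show ?thesis
      by (simp only: funpow_0 circle_differentiable_cis)
  qed
  ultimately show ?case
    by simp
qed simp

section \<open>Frenet data of a translator\<close>

theorem proposition10:
  fixes \<gamma> \<nu> :: "complex \<Rightarrow> real ^ 2" and V :: "real ^ 2"
  assumes "smooth_closed_curve \<gamma>"
    and "unit_normal_field \<gamma> \<nu>"
    and "curve_diffusion_translator \<gamma> \<nu> V"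
  shows "V = 0 \<and> (\<exists>c r. r > 0 \<and> \<gamma> ` unit_circle = sphere c r)"
proof -
  define g where "g = (\<lambda>t. \<gamma> (cis t))"
  define N where "N = (\<lambda>t. \<nu> (cis t))"
  define v where "v = (\<lambda>t. norm (vderiv g t))"
  \<comment> \<open>This is the reciprocal of the speed, in the form whose differentiability is
    already established.\<close>
  define w where "w = (\<lambda>t. inverse (sqrt (vderiv g t \<bullet> vderiv g t)))"
  define \<tau> where "\<tau> = (\<lambda>t. arclength_deriv \<gamma> \<gamma> (cis t))"
  define \<kappa> where "\<kappa> = (\<lambda>t. curvature \<gamma> \<nu> (cis t))"
  define \<kappa>\<^sub>1 where "\<kappa>\<^sub>1 = (\<lambda>t. arclength_deriv \<gamma> (curvature \<gamma> \<nu>) (cis t))"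
  have arclength: "arclength_deriv \<gamma> f (cis t) = w t *\<^sub>R vderiv (\<lambda>t. f (cis t)) t"
    for f :: "complex \<Rightarrow> 'b::real_normed_vector" and t
    by (simp add: arclength_deriv_def circle_deriv_cis w_def g_def norm_eq_sqrt_inner)
  have \<tau>: "\<tau> = (\<lambda>t. w t *\<^sub>R vderiv g t)"
    by (simp add: \<tau>_def arclength g_def)
  have \<kappa>: "\<kappa> = (\<lambda>t. (w t *\<^sub>R vderiv \<tau> t) \<bullet> N t)"
    by (simp add: \<kappa>_def curvature_def arclength N_def flip: \<tau>_def)
      (simp add: \<tau>_def arclength)
  have \<kappa>\<^sub>1: "\<kappa>\<^sub>1 = (\<lambda>t. w t *\<^sub>R vderiv \<kappa> t)"
    by (simp add: \<kappa>\<^sub>1_def arclength \<kappa>_def)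
  have v_pos: "0 < v t" for t
    using assms(1) cis_in_unit_circle[of t]
    unfolding smooth_closed_curve_def v_def g_def by (simp flip: circle_deriv_cis)
  have v_w: "v t * w t = 1" for t
    using v_pos[of t] by (simp add: v_def w_def norm_eq_sqrt_inner)
  have diff_g: "times_differentiable n g" and diff_N: "times_differentiable n N" for n
    using assms smooth_on_circle_times_differentiable
    by (auto simp: smooth_closed_curve_def unit_normal_field_def g_def N_def)
  have diff_g': "times_differentiable n (vderiv g)" for n
    using diff_g[of "Suc n"] by simp
  have diff_w: "times_differentiable n w" for n
    unfolding w_def using v_pos
    by (intro times_differentiable_inverse_sqrt times_differentiable_inner diff_g')
      (simp add: v_def)
  have diff_\<tau>: "times_differentiable n \<tau>" for n
    unfolding \<tau> by (intro times_differentiable_scaleR diff_w diff_g')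
  have diff_\<kappa>: "times_differentiable n \<kappa>" for n
    unfolding \<kappa> using diff_\<tau>[of "Suc n"]
    by (intro times_differentiable_inner times_differentiable_scaleR diff_w diff_N) simp
  have diff_\<kappa>\<^sub>1: "times_differentiable n \<kappa>\<^sub>1" for n
    unfolding \<kappa>\<^sub>1 using diff_\<kappa>[of "Suc n"]
    by (intro times_differentiable_scaleR diff_w) simp
  note derivs = has_vector_derivative_vderiv[of 0]
  have vderiv_g: "vderiv g t = v t *\<^sub>R \<tau> t" for t
    by (simp add: \<tau> v_w)
  have norm_\<tau>: "norm (\<tau> t) = 1" for t
  proof -
    have "norm (\<tau> t) = \<bar>w t\<bar> * v t"
      by (simp add: \<tau> v_def)
    also have "\<dots> = \<bar>v t * w t\<bar>"
      using v_pos[of t] by (simp add: abs_mult)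
    finally show ?thesis
      by (simp add: v_w)
  qed
  have norm_N: "norm (N t) = 1" for t
    using assms(2) cis_in_unit_circle unfolding unit_normal_field_def N_def by blast
  have \<tau>_N: "\<tau> t \<bullet> N t = 0" for t
  proof -
    have "N t \<bullet> circle_deriv \<gamma> (cis t) = 0"
      using assms(2) cis_in_unit_circle unfolding unit_normal_field_def N_def by blast
    then show ?thesis
      by (simp add: \<tau> g_def circle_deriv_cis inner_commute)
  qed
  \<comment> \<open>Differentiating the constants \<open>\<tau> \<bullet> \<tau>\<close>,
    \<open>N \<bullet> N\<close> and \<open>\<tau> \<bullet> N\<close> yields the Frenet equations
    once the derivatives are expanded in the frame.\<close>
  have deriv_const: "f t \<bullet> vderiv h t + vderiv f t \<bullet> h t = 0"
    if "times_differentiable (Suc 0) f" "times_differentiable (Suc 0) h" "\<And>t. f t \<bullet> h t = c"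
    for f h :: "real \<Rightarrow> real ^ 2" and c t
    using has_vector_derivative_inner[OF derivs[OF that(1)] derivs[OF that(2)], of t] that(3)
    by (auto dest: DERIV_unique[OF DERIV_const])
  have \<tau>'_\<tau>: "vderiv \<tau> t \<bullet> \<tau> t = 0" and N'_N: "vderiv N t \<bullet> N t = 0" for t
    using deriv_const[OF diff_\<tau> diff_\<tau>, of 1 t] deriv_const[OF diff_N diff_N, of 1 t] norm_\<tau> norm_N
    by (simp_all add: norm_eq_1 inner_commute)
  have \<tau>'_N: "vderiv \<tau> t \<bullet> N t = v t * \<kappa> t" for t
    using v_w[of t] by (simp add: \<kappa> flip: mult.assoc)
  have N'_\<tau>: "vderiv N t \<bullet> \<tau> t = - (v t * \<kappa> t)" for t
    using deriv_const[OF diff_\<tau> diff_N \<tau>_N, of t] \<tau>'_N[of t] by (simp add: inner_commute)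
  have vderiv_\<tau>: "vderiv \<tau> t = (v t * \<kappa> t) *\<^sub>R N t" for t
    using frame_expansion[OF norm_\<tau> norm_N \<tau>_N, of "vderiv \<tau> t" t] \<tau>'_\<tau> \<tau>'_N by simp
  have vderiv_N: "vderiv N t = - (v t * \<kappa> t) *\<^sub>R \<tau> t" for t
    using frame_expansion[OF norm_\<tau> norm_N \<tau>_N, of "vderiv N t" t] N'_N N'_\<tau> by simp
  have vderiv_\<kappa>: "vderiv \<kappa> t = v t * \<kappa>\<^sub>1 t" for t
    using v_w[of t] by (simp add: \<kappa>\<^sub>1 flip: mult.assoc)
  have vderiv_\<kappa>\<^sub>1: "vderiv \<kappa>\<^sub>1 t = - (v t * (V \<bullet> N t))" for t
  proof -
    have "- arclength_deriv \<gamma> (arclength_deriv \<gamma> (curvature \<gamma> \<nu>)) (cis t) = V \<bullet> N t"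
      using assms(3) cis_in_unit_circle unfolding curve_diffusion_translator_def N_def by blast
    then have "- (w t * vderiv \<kappa>\<^sub>1 t) = V \<bullet> N t"
      by (simp add: \<kappa>\<^sub>1_def arclength)
    then have "- (v t * (V \<bullet> N t)) = (v t * w t) * vderiv \<kappa>\<^sub>1 t"
      by (metis minus_mult_right minus_minus mult.assoc)
    then show ?thesis
      by (simp add: v_w)
  qed
  have cis_periodic: "cis (t + 2 * pi) = cis t" for t
    by (simp add: cis_conv_exp algebra_simps exp_add)
  interpret closed_frenet_curve g \<tau> N v \<kappa> \<kappa>\<^sub>1
    using derivs[OF diff_g] derivs[OF diff_\<tau>] derivs[OF diff_N] derivs[OF diff_\<kappa>]
    by unfold_locales
      (auto simp: v_pos norm_\<tau> norm_N \<tau>_N vderiv_g vderiv_\<tau> vderiv_N vderiv_\<kappa>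
        has_real_derivative_iff_has_vector_derivative,
       simp_all add: g_def \<tau>_def N_def \<kappa>_def \<kappa>\<^sub>1_def cis_periodic)
  have \<kappa>\<^sub>1_deriv: "(\<kappa>\<^sub>1 has_real_derivative - (v t * (V \<bullet> N t))) (at t)" for t
    using derivs[OF diff_\<kappa>\<^sub>1, of t]
    by (simp add: vderiv_\<kappa>\<^sub>1 has_real_derivative_iff_has_vector_derivative)
  then have \<kappa>\<^sub>1_0: "\<kappa>\<^sub>1 t = 0" for t
    by (rule translator_curvature_deriv_eq_0)
  have "V \<bullet> N t = 0" for t
  proof -
    \<comment> \<open>The zero function has derivative zero, which must agree with the derivative
      that the translator equation prescribes.\<close>
    have "\<kappa>\<^sub>1 = (\<lambda>t. 0)"
      using \<kappa>\<^sub>1_0 by blast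
    then have "- (v t * (V \<bullet> N t)) = 0"
      using \<kappa>\<^sub>1_deriv[of t] by (metis DERIV_const DERIV_unique)
    with v_pos[of t] show ?thesis
      by simp
  qed
  then have "V = 0"
    by (rule normal_orthogonal_imp_eq_0)
  moreover have "\<exists>c r. r > 0 \<and> \<gamma> ` unit_circle = sphere c r"
    using const_curvature_imp_circle[OF \<kappa>\<^sub>1_0] by (simp add: image_unit_circle g_def)
  ultimately show ?thesis
    by blast
qed

end
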